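(* For all $k,v\in\mathbb{N}$ such that $k\le 2v+1$, $$f_{2v+1,k}=\binom{v+1}{k}+\sum_{j\ge 1}\frac{(k-2j+1)_{j-1}\,(v+j-k+2)_{k-2j}}{j!\,(k-2j-1)!},$$ where $f_{2v+1,k}$ is the number of order ideals of cardinality $k$ of the fence poset $\mathcal{Z}_{2v+1}$, and a summand with $k-2j-1<0$ is read as $0$.
   Context: $\mathbb{N}$ contains $0$. The fence poset $\mathcal{Z}_n$ of order $n$ is the poset on $\{z_1,\dots,z_n\}$ whose cover relations are exactly $z_{2j-1}\triangleleft z_{2j}\triangleright z_{2j+1}$ for all $j\ge1$ (whenever the indices lie in $\{1,\dots,n\}$), so odd-indexed elements are minimal. An order ideal of a poset $P$ is a subset $I\subseteq P$ such that $y\in I$ and $z\le y$ imply $z\in I$. $f_{n,k}$ denotes the number of order ideals of $\mathcal{Z}_n$ with exactly $k$ elements (the $k$-th Whitney number of the distributive lattice of order ideals of $\mathcal{Z}_n$, whose rank function is cardinality). Rising factorial: $(a)_0=1$ and $(a)_m=\prod_{i=0}^{m-1}(a+i)$ for integers $m\ge1$. $\binom{a}{b}=0$ for integers $b>a\ge0$. Convention: $1/(m!)=0$ for negative integers $m$, so a summand with $k-2j-1<0$ is $0$ and the sum effectively runs over $1\le j\le (k-1)/2$. *)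

theory Defs
  imports Complex_Main
begin

text \<open>
  The element \<open>z_i\<close> of the fence is represented by its index \<open>i \<in> {1..n}\<close>. A pair \<open>(x, y)\<close> in
  \<open>fence_covers n\<close> means that \<open>z_y\<close> covers \<open>z_x\<close>.
\<close>

definition fence_covers :: "nat \<Rightarrow> nat rel" where
  "fence_covers n = {(2 * j - 1, 2 * j) | j. 1 \<le> j \<and> 2 * j \<le> n}
                  \<union> {(2 * j + 1, 2 * j) | j. 1 \<le> j \<and> 2 * j + 1 \<le> n}"

definition fence :: "nat \<Rightarrow> nat rel" where
  "fence n = Id_on {1..n} \<union> (fence_covers n)\<^sup>+"

definition order_ideal :: "'a set \<Rightarrow> 'a rel \<Rightarrow> 'a set \<Rightarrow> bool" where
  "order_ideal P r I \<longleftrightarrow> I \<subseteq> P \<and> (\<forall>y\<in>I. \<forall>z\<in>P. (z, y) \<in> r \<longrightarrow> z \<in> I)"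

definition fence_ideal_count :: "nat \<Rightarrow> nat \<Rightarrow> nat" where
  "fence_ideal_count n k = card {I. order_ideal {1..n} (fence n) I \<and> card I = k}"

lemma fence_covers_parity:
  assumes "(x, y) \<in> fence_covers n"
  shows "odd x" "even y" "x \<in> {1..n}" "y \<in> {1..n}"
  using assms by (auto simp: fence_covers_def)

lemma trancl_fence_covers: "(fence_covers n)\<^sup>+ = fence_covers n"
proof (rule trancl_id, rule transI)
  fix x y z
  assume "(x, y) \<in> fence_covers n" "(y, z) \<in> fence_covers n"
  then have "even y" "odd y"
    by (auto dest: fence_covers_parity)
  then show "(x, z) \<in> fence_covers n" by simp
qed

lemma partial_order_on_fence: "partial_order_on {1..n} (fence n)"
  unfolding partial_order_on_def preorder_on_def fence_def trancl_fence_covers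
  by (auto simp: refl_on_def trans_def antisym_def dest: fence_covers_parity)

lemma fence_covers_iff:
  "(x, y) \<in> fence_covers n \<longleftrightarrow>
     (x, y) \<in> fence n \<and> x \<noteq> y \<and> (\<forall>w. (x, w) \<in> fence n \<and> (w, y) \<in> fence n \<longrightarrow> w = x \<or> w = y)"
  unfolding fence_def trancl_fence_covers
  by (auto dest: fence_covers_parity)

end

theory Submission
  imports Defs
begin

text \<open>
  Refine the count by the numbers \<open>m\<close> of odd and \<open>j\<close> of even indices in an ideal. Deleting the
  last element of the fence (together with the element below it, if the last one is maximal and
  lies in the ideal) gives Pascal-type recurrences between the refined counts of
  \<open>\<Z>\<^sub>2\<^sub>n\<^sub>-\<^sub>1\<close> and \<open>\<Z>\<^sub>2\<^sub>n\<close>, whose solutions are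
  \<open>(m - 1 choose j) * (n - j choose m - j)\<close> and \<open>(m choose j) * (n - j choose m - j)\<close>.
  The summand of the theorem is the first of these products for \<open>n = v + 1\<close> and \<open>m = k - j\<close>.
\<close>

definition fence_ideals :: "nat \<Rightarrow> nat set set" where
  "fence_ideals n = {I. order_ideal {1..n} (fence n) I}"

definition fence_ideal_bicount :: "nat \<Rightarrow> nat \<Rightarrow> nat \<Rightarrow> nat" where
  "fence_ideal_bicount n m j =
     card {I \<in> fence_ideals n. card {i \<in> I. odd i} = m \<and> card {i \<in> I. even i} = j}"

section \<open>Order ideals in terms of neighbouring indices\<close>

lemma fence_covers_iff_neighbours:
  "(x, y) \<in> fence_covers n \<longleftrightarrow> even y \<and> x \<in> {1..n} \<and> y \<in> {1..n} \<and> (Suc x = y \<or> x = Suc y)"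
proof
  assume "(x, y) \<in> fence_covers n"
  then show "even y \<and> x \<in> {1..n} \<and> y \<in> {1..n} \<and> (Suc x = y \<or> x = Suc y)"
    by (auto simp: fence_covers_def)
next
  assume R: "even y \<and> x \<in> {1..n} \<and> y \<in> {1..n} \<and> (Suc x = y \<or> x = Suc y)"
  then obtain j where "y = 2 * j" by (auto elim: evenE)
  with R have "1 \<le> j" "x = 2 * j - 1 \<and> 2 * j \<le> n \<or> x = 2 * j + 1 \<and> 2 * j + 1 \<le> n"
    by auto
  with \<open>y = 2 * j\<close> show "(x, y) \<in> fence_covers n"
    unfolding fence_covers_def by blast
qed

lemma fence_below_eq:
  assumes "y \<in> {1..n}"
  shows "{z \<in> {1..n}. (z, y) \<in> fence n} =
    (if even y then insert y (insert (y - 1) (if y < n then {Suc y} else {})) else {y})"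
proof -
  have "{z \<in> {1..n}. (z, y) \<in> fence n} =
      insert y {z \<in> {1..n}. even y \<and> (Suc z = y \<or> z = Suc y)}"
    using assms by (auto simp: fence_def trancl_fence_covers fence_covers_iff_neighbours)
  also have "\<dots> = (if even y then insert y (insert (y - 1) (if y < n then {Suc y} else {})) else {y})"
  proof (cases "even y")
    case True
    with assms obtain x where x: "y = Suc x" "1 \<le> x" by (cases y; cases "y - 1") auto
    then show ?thesis using True assms by (simp add: set_eq_iff) linarith
  qed simp
  finally show ?thesis .
qed

text \<open>Chains have at most two elements, so only even indices impose conditions. The left
  neighbour of an even index always exists, as the index is at least 2; the right one is missing
  exactly when the index is \<open>n\<close>.\<close>

lemma mem_fence_ideals_iff:
  "I \<in> fence_ideals n \<longleftrightarrow>
     (\<forall>y\<in>I. 1 \<le> y \<and> y \<le> n \<and> (even y \<longrightarrow> y - 1 \<in> I \<and> (y < n \<longrightarrow> Suc y \<in> I)))"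
proof -
  have "(\<forall>z\<in>{1..n}. (z, y) \<in> fence n \<longrightarrow> z \<in> I) \<longleftrightarrow>
        (even y \<longrightarrow> y - 1 \<in> I \<and> (y < n \<longrightarrow> Suc y \<in> I))" if "y \<in> I" "y \<in> {1..n}" for y
  proof -
    have "(\<forall>z\<in>{1..n}. (z, y) \<in> fence n \<longrightarrow> z \<in> I) \<longleftrightarrow> {z \<in> {1..n}. (z, y) \<in> fence n} \<subseteq> I"
      by blast
    then show ?thesis
      unfolding fence_below_eq[OF that(2)] using that(1) by simp
  qed
  then show ?thesis
    by (simp add: fence_ideals_def order_ideal_def subset_iff) blast
qed

lemma fence_idealsI:
  assumes "\<And>y. y \<in> I \<Longrightarrow> 1 \<le> y \<and> y \<le> n"
    and "\<And>y. y \<in> I \<Longrightarrow> even y \<Longrightarrow> y - 1 \<in> I"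
    and "\<And>y. y \<in> I \<Longrightarrow> even y \<Longrightarrow> y < n \<Longrightarrow> Suc y \<in> I"
  shows "I \<in> fence_ideals n"
  using assms by (simp add: mem_fence_ideals_iff)

lemma fence_idealsD:
  assumes "I \<in> fence_ideals n" "y \<in> I"
  shows "1 \<le> y" "y \<le> n" "even y \<Longrightarrow> y - 1 \<in> I" "even y \<Longrightarrow> y < n \<Longrightarrow> Suc y \<in> I"
  using assms by (simp_all add: mem_fence_ideals_iff)

lemma fence_ideals_subset: "I \<in> fence_ideals n \<Longrightarrow> I \<subseteq> {1..n}"
  by (meson atLeastAtMost_iff fence_idealsD(1,2) subsetI)

lemma finite_fence_ideals: "finite (fence_ideals n)"
proof (rule finite_subset)
  show "fence_ideals n \<subseteq> Pow {1..n}" using fence_ideals_subset by blast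
qed simp

lemma finite_fence_ideal: "I \<in> fence_ideals n \<Longrightarrow> finite I"
  by (meson fence_ideals_subset finite_atLeastAtMost finite_subset)

section \<open>Extension, restriction and recursive decomposition of ideals\<close>

lemma fence_ideals_0: "fence_ideals 0 = {{}}"
  by (auto simp: mem_fence_ideals_iff)

lemma fence_ideals_extend:
  assumes "I \<in> fence_ideals n" "odd n \<or> n = 0" "n \<le> N"
  shows "I \<in> fence_ideals N"
proof (rule fence_idealsI)
  fix y assume y: "y \<in> I"
  show "1 \<le> y \<and> y \<le> N" using fence_idealsD(1,2)[OF assms(1) y] assms(3) by simp
  show "y - 1 \<in> I" if "even y" by (rule fence_idealsD(3)[OF assms(1) y that])
  show "Suc y \<in> I" if "even y"
  proof (rule fence_idealsD(4)[OF assms(1) y that])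
    have "y \<noteq> n" using that assms(2) fence_idealsD(1)[OF assms(1) y] by auto
    then show "y < n" using fence_idealsD(2)[OF assms(1) y] by simp
  qed
qed

text \<open>\<open>J\<close> is the trace of \<open>I\<close> on the first \<open>n\<close> indices;
  the elementwise hypothesis allows \<open>J\<close> to be \<open>I\<close> itself or
  \<open>I\<close> with its last indices removed.\<close>

lemma fence_ideals_restrict:
  assumes "I \<in> fence_ideals N" "\<And>y. y \<in> J \<longleftrightarrow> y \<in> I \<and> y \<le> n" "n \<le> N"
  shows "J \<in> fence_ideals n"
proof (rule fence_idealsI)
  fix y assume "y \<in> J"
  then have y: "y \<in> I" "y \<le> n" using assms(2) by auto
  show "1 \<le> y \<and> y \<le> n" using fence_idealsD(1)[OF assms(1) y(1)] y(2) by simp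
  show "y - 1 \<in> J" if "even y" using fence_idealsD(3)[OF assms(1) y(1) that] y(2) assms(2) by simp
  show "Suc y \<in> J" if "even y" "y < n"
    using fence_idealsD(4)[OF assms(1) y(1) that(1)] that(2) assms(2,3) by simp
qed

text \<open>For \<open>n = 0\<close> the truncated subtraction makes the first family \<open>fence_ideals 0\<close>.\<close>

lemma fence_ideals_odd:
  "fence_ideals (2 * n + 1) =
     fence_ideals (2 * n - 1) \<union> insert (2 * n + 1) ` fence_ideals (2 * n)" (is "?A = ?B \<union> ?f ` ?C")
proof (intro set_eqI iffI)
  fix I assume I: "I \<in> ?A"
  show "I \<in> ?B \<union> ?f ` ?C"
  proof (cases "2 * n + 1 \<in> I")
    case True
    then have "I = ?f (I - {2 * n + 1})" by blast
    moreover have "I - {2 * n + 1} \<in> ?C"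
    proof (rule fence_ideals_restrict[OF I])
      fix y show "y \<in> I - {2 * n + 1} \<longleftrightarrow> y \<in> I \<and> y \<le> 2 * n"
        using fence_idealsD(2)[OF I, of y] by auto
    qed simp
    ultimately show ?thesis by blast
  next
    case False
    then have "2 * n \<notin> I" using fence_idealsD(4)[OF I, of "2 * n"] by auto
    have "I \<in> ?B"
    proof (rule fence_ideals_restrict[OF I])
      fix y
      have "y \<noteq> 2 * n" "y \<noteq> 2 * n + 1" if "y \<in> I" using that False \<open>2 * n \<notin> I\<close> by auto
      then show "y \<in> I \<longleftrightarrow> y \<in> I \<and> y \<le> 2 * n - 1"
        using fence_idealsD(2)[OF I, of y] by linarith
    qed simp
    then show ?thesis ..
  qed
next
  fix I assume "I \<in> ?B \<union> ?f ` ?C"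
  then show "I \<in> ?A"
  proof
    assume "I \<in> ?B"
    then show ?thesis by (rule fence_ideals_extend) auto
  next
    assume "I \<in> ?f ` ?C"
    then obtain J where J: "J \<in> ?C" and IJ: "I = insert (2 * n + 1) J" by blast
    show ?thesis
    proof (rule fence_idealsI)
      fix y assume y: "y \<in> I"
      show "1 \<le> y \<and> y \<le> 2 * n + 1" using y fence_idealsD(1,2)[OF J, of y] IJ by auto
      show "y - 1 \<in> I" if "even y" using y fence_idealsD(3)[OF J, of y] IJ that by auto
      \<comment> \<open>As the last index of the smaller fence, \<open>2 * n\<close> has no right
        neighbour there; the one it now needs is the inserted \<open>2 * n + 1\<close>.\<close>
      show "Suc y \<in> I" if "even y"
        using y fence_idealsD(2,4)[OF J, of y] IJ that by (cases "y = 2 * n") auto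
    qed
  qed
qed

text \<open>The last index is maximal and lies above \<open>2 * n + 1\<close> only, so the two are
  inserted together. Any ideal of the fence of order \<open>2 * n\<close> may remain, because
  \<open>2 * n + 1\<close> is also the neighbour that \<open>2 * n\<close> would need.\<close>

lemma fence_ideals_even:
  "fence_ideals (2 * n + 2) =
     fence_ideals (2 * n + 1) \<union>
     (\<lambda>I. insert (2 * n + 2) (insert (2 * n + 1) I)) ` fence_ideals (2 * n)"
  (is "?A = ?B \<union> ?f ` ?C")
proof (intro set_eqI iffI)
  fix I assume I: "I \<in> ?A"
  show "I \<in> ?B \<union> ?f ` ?C"
  proof (cases "2 * n + 2 \<in> I")
    case True
    then have "2 * n + 1 \<in> I" using fence_idealsD(3)[OF I True] by simp
    with True have "I = ?f (I - {2 * n + 1, 2 * n + 2})" by blast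
    moreover have "I - {2 * n + 1, 2 * n + 2} \<in> ?C"
    proof (rule fence_ideals_restrict[OF I])
      fix y show "y \<in> I - {2 * n + 1, 2 * n + 2} \<longleftrightarrow> y \<in> I \<and> y \<le> 2 * n"
        using fence_idealsD(2)[OF I, of y] by auto
    qed simp
    ultimately show ?thesis by blast
  next
    case False
    have "I \<in> ?B"
    proof (rule fence_ideals_restrict[OF I])
      fix y
      have "y \<noteq> 2 * n + 2" if "y \<in> I" using that False by auto
      then show "y \<in> I \<longleftrightarrow> y \<in> I \<and> y \<le> 2 * n + 1"
        using fence_idealsD(2)[OF I, of y] by linarith
    qed simp
    then show ?thesis ..
  qed
next
  fix I assume "I \<in> ?B \<union> ?f ` ?C"
  then show "I \<in> ?A"
  proof
    assume "I \<in> ?B"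
    then show ?thesis by (rule fence_ideals_extend) auto
  next
    assume "I \<in> ?f ` ?C"
    then obtain J where J: "J \<in> ?C" and IJ: "I = ?f J" by blast
    show ?thesis
    proof (rule fence_idealsI)
      fix y assume y: "y \<in> I"
      show "1 \<le> y \<and> y \<le> 2 * n + 2" using y fence_idealsD(1,2)[OF J, of y] IJ by auto
      show "y - 1 \<in> I" if "even y" using y fence_idealsD(3)[OF J, of y] IJ that by auto
      show "Suc y \<in> I" if "even y" "y < 2 * n + 2"
        using y fence_idealsD(2,4)[OF J, of y] IJ that by (cases "y = 2 * n") auto
    qed
  qed
qed

section \<open>Recurrences for the refined counts and their solution\<close>

lemma fence_ideal_bicount_0: "fence_ideal_bicount 0 m j = (if m = 0 \<and> j = 0 then 1 else 0)"
proof -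
  have "{I \<in> fence_ideals 0. card {i \<in> I. odd i} = m \<and> card {i \<in> I. even i} = j} =
      (if m = 0 \<and> j = 0 then {{}} else {})"
    by (auto simp: fence_ideals_0)
  then show ?thesis by (simp add: fence_ideal_bicount_def)
qed

lemma card_filter_insert:
  assumes "finite I" "x \<notin> I"
  shows "card {i \<in> insert x I. P i} = card {i \<in> I. P i} + (if P x then 1 else 0)"
proof -
  have "{i \<in> insert x I. P i} = (if P x then insert x {i \<in> I. P i} else {i \<in> I. P i})"
    by auto
  with assms show ?thesis by simp
qed

text \<open>The two families of \<open>fence_ideals_odd\<close> are disjoint, since only the second
  contains \<open>2 * n + 1\<close>. Inserting this odd index is injective, raises \<open>m\<close>
  by one and keeps \<open>j\<close>.\<close>

lemma fence_ideal_bicount_odd: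
  "fence_ideal_bicount (2 * n + 1) m j =
     fence_ideal_bicount (2 * n - 1) m j +
     (case m of 0 \<Rightarrow> 0 | Suc m' \<Rightarrow> fence_ideal_bicount (2 * n) m' j)"
proof -
  define Q where "Q m I \<longleftrightarrow> card {i \<in> I. odd i} = m \<and> card {i \<in> I. even i} = j"
    for m and I :: "nat set"
  let ?f = "insert (2 * n + 1)"
  define T where "T = {I \<in> fence_ideals (2 * n). Q m (?f I)}"
  have new: "2 * n + 1 \<notin> I" if "I \<in> fence_ideals (2 * n) \<or> I \<in> fence_ideals (2 * n - 1)" for I
    using that by (auto dest: fence_idealsD(2))
  have "{I \<in> fence_ideals (2 * n + 1). Q m I} = {I \<in> fence_ideals (2 * n - 1). Q m I} \<union> ?f ` T"
    unfolding fence_ideals_odd T_def by blast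
  moreover have "{I \<in> fence_ideals (2 * n - 1). Q m I} \<inter> ?f ` T = {}"
    using new by fastforce
  moreover have "card (?f ` T) = card T"
  proof (rule card_image, rule inj_onI)
    fix A B assume "A \<in> T" "B \<in> T" "?f A = ?f B"
    with new show "A = B" unfolding T_def by (metis (no_types, lifting) insert_ident mem_Collect_eq)
  qed
  moreover have "finite T" by (simp add: T_def finite_fence_ideals)
  ultimately have "card {I \<in> fence_ideals (2 * n + 1). Q m I} =
      card {I \<in> fence_ideals (2 * n - 1). Q m I} + card T"
    by (simp add: card_Un_disjoint finite_fence_ideals)
  moreover have "T = (case m of 0 \<Rightarrow> {} | Suc m' \<Rightarrow> {I \<in> fence_ideals (2 * n). Q m' I})"
  proof -
    have "Q m (?f I) \<longleftrightarrow> (\<exists>m'. m = Suc m' \<and> Q m' I)" if "I \<in> fence_ideals (2 * n)" for I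
      unfolding Q_def using new finite_fence_ideal[OF that] that
      by (auto simp: card_filter_insert simp del: insert_iff)
    then show ?thesis by (auto simp: T_def split: nat.split)
  qed
  ultimately show ?thesis
    by (simp add: fence_ideal_bicount_def Q_def split: nat.split)
qed

lemma fence_ideal_bicount_even:
  "fence_ideal_bicount (2 * n + 2) m j =
     fence_ideal_bicount (2 * n + 1) m j +
     (case (m, j) of (Suc m', Suc j') \<Rightarrow> fence_ideal_bicount (2 * n) m' j' | _ \<Rightarrow> 0)"
proof -
  define Q where "Q m j I \<longleftrightarrow> card {i \<in> I. odd i} = m \<and> card {i \<in> I. even i} = j"
    for m j and I :: "nat set"
  let ?f = "\<lambda>I. insert (2 * n + 2) (insert (2 * n + 1) I)"
  define T where "T = {I \<in> fence_ideals (2 * n). Q m j (?f I)}"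
  have new: "2 * n + 1 \<notin> I" "2 * n + 2 \<notin> insert (2 * n + 1) I" if "I \<in> fence_ideals (2 * n)" for I
    using that by (auto dest: fence_idealsD(2))
  have new': "2 * n + 2 \<notin> I" if "I \<in> fence_ideals (2 * n + 1)" for I
    using that by (auto dest: fence_idealsD(2))
  have "{I \<in> fence_ideals (2 * n + 2). Q m j I} =
      {I \<in> fence_ideals (2 * n + 1). Q m j I} \<union> ?f ` T"
    unfolding fence_ideals_even T_def by blast
  moreover have "{I \<in> fence_ideals (2 * n + 1). Q m j I} \<inter> ?f ` T = {}"
    using new' by fastforce
  moreover have "card (?f ` T) = card T"
  proof (rule card_image, rule inj_onI)
    fix A B assume "A \<in> T" "B \<in> T" "?f A = ?f B"
    with new show "A = B" unfolding T_def by (metis (no_types, lifting) insert_ident mem_Collect_eq)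
  qed
  moreover have "finite T" by (simp add: T_def finite_fence_ideals)
  ultimately have "card {I \<in> fence_ideals (2 * n + 2). Q m j I} =
      card {I \<in> fence_ideals (2 * n + 1). Q m j I} + card T"
    by (simp add: card_Un_disjoint finite_fence_ideals)
  moreover have "T = (case (m, j) of
      (Suc m', Suc j') \<Rightarrow> {I \<in> fence_ideals (2 * n). Q m' j' I} | _ \<Rightarrow> {})"
  proof -
    have "Q m j (?f I) \<longleftrightarrow> (\<exists>m' j'. m = Suc m' \<and> j = Suc j' \<and> Q m' j' I)"
      if "I \<in> fence_ideals (2 * n)" for I
      unfolding Q_def using new[OF that] finite_fence_ideal[OF that]
      by (auto simp: card_filter_insert simp del: insert_iff)
    then show ?thesis by (auto simp: T_def split: nat.split)
  qed
  ultimately show ?thesis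
    by (simp add: fence_ideal_bicount_def Q_def split: nat.split)
qed

text \<open>
  The guard \<open>m \<le> n\<close> excludes junk values such as \<open>m = j = n + 1\<close>, where the truncated \<open>n - j\<close>
  and \<open>m - j\<close> would make the product \<open>1\<close>.
\<close>

lemma fence_ideal_bicount_eq:
  "fence_ideal_bicount (2 * n - 1) m j =
     (if m \<le> n then (m - 1 choose j) * (n - j choose (m - j)) else 0) \<and>
   fence_ideal_bicount (2 * n) m j =
     (if m \<le> n then (m choose j) * (n - j choose (m - j)) else 0)"
proof (induction n arbitrary: m j)
  case 0
  show ?case by (auto simp: fence_ideal_bicount_0)
next
  case (Suc n)
  note IH = Suc.IH[THEN conjunct1] Suc.IH[THEN conjunct2]
  \<comment> \<open>The odd order comes first, because the recurrence for \<open>2 * n + 2\<close>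
    refers to it.\<close>
  have odd: "fence_ideal_bicount (2 * n + 1) m j =
      (if m \<le> Suc n then (m - 1 choose j) * (Suc n - j choose (m - j)) else 0)" for m j
  proof (cases m)
    case 0
    then show ?thesis
      by (subst fence_ideal_bicount_odd) (cases j; simp add: IH[simplified])
  next
    case (Suc m')
    show ?thesis
    proof (cases "j \<le> m' \<and> m' \<le> n")
      case True
      \<comment> \<open>Both terms share the factor \<open>m' choose j\<close>, and Pascal's rule
        merges the second factors. If \<open>m' = n\<close>, the guard removes the first term, in
        agreement with \<open>n - j choose (m - j)\<close> being 0.\<close>
      then have "Suc n - j = Suc (n - j)" "m - j = Suc (m' - j)" using Suc by auto
      with True Suc show ?thesis
        by (subst fence_ideal_bicount_odd) (auto simp: IH[simplified] distrib_left)
    next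
      case False
      \<comment> \<open>Either \<open>m' choose j\<close> vanishes or \<open>m' > n\<close> makes
        every guard fail.\<close>
      with Suc show ?thesis
        by (subst fence_ideal_bicount_odd) (auto simp: IH[simplified])
    qed
  qed
  moreover have "fence_ideal_bicount (2 * n + 2) m j =
      (if m \<le> Suc n then (m choose j) * (Suc n - j choose (m - j)) else 0)"
    \<comment> \<open>When \<open>m\<close> and \<open>j\<close> are both positive, the second
      factors agree, and Pascal's rule acts on the first ones.\<close>
    unfolding fence_ideal_bicount_even odd
    by (cases m; cases j) (auto simp: IH[simplified] distrib_right)
  ultimately show ?case by simp
qed

section \<open>Summation over the even elements and comparison with the formula\<close>

lemma fence_ideal_count_eq_sum_bicount:
  "fence_ideal_count n k = (\<Sum>j\<le>k. fence_ideal_bicount n (k - j) j)"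
proof -
  let ?S = "\<lambda>j. {I \<in> fence_ideals n. card {i \<in> I. odd i} = k - j \<and> card {i \<in> I. even i} = j}"
  have "card I = card {i \<in> I. odd i} + card {i \<in> I. even i}" if "I \<in> fence_ideals n" for I
  proof -
    have "card ({i \<in> I. odd i} \<union> {i \<in> I. even i}) = card {i \<in> I. odd i} + card {i \<in> I. even i}"
      using finite_fence_ideal[OF that] by (intro card_Un_disjoint) auto
    moreover have "{i \<in> I. odd i} \<union> {i \<in> I. even i} = I" by blast
    ultimately show ?thesis by simp
  qed
  then have "{I. order_ideal {1..n} (fence n) I \<and> card I = k} = (\<Union>j\<in>{..k}. ?S j)"
    by (auto simp: fence_ideals_def)
  then show ?thesis
    unfolding fence_ideal_count_def fence_ideal_bicount_def
    by (simp only:) (subst card_UN_disjoint; auto simp: finite_fence_ideals)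
qed

lemma pochhammer_Suc_of_nat:
  "pochhammer (of_nat (Suc n) :: 'a :: field_char_0) m = fact (n + m) / fact n"
proof (induction m)
  case (Suc m)
  have "of_nat (Suc n) + of_nat m = (of_nat (Suc (n + m)) :: 'a)" by simp
  then show ?case by (simp only: pochhammer_Suc Suc.IH) (simp add: mult.commute)
qed simp

text \<open>If \<open>k - j \<le> v + 1\<close>, both rising factorials are quotients of factorials;
  the \<open>fact (k - 2 * j)\<close> dividing the first one completes the denominator of the second
  binomial. Otherwise both sides vanish.\<close>

lemma summand_eq_fence_ideal_bicount:
  assumes "1 \<le> j" "2 * j + 1 \<le> k" "k \<le> 2 * v + 1"
  shows "pochhammer (real k - 2 * real j + 1) (j - 1) *
         pochhammer (real v + real j - real k + 2) (k - 2 * j) /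
         (fact j * fact (k - 2 * j - 1)) = real (fence_ideal_bicount (2 * v + 1) (k - j) j)"
proof (cases "k - j \<le> v + 1")
  case True
  have 1: "real k - 2 * real j + 1 = real (Suc (k - 2 * j))" using assms by simp
  have 2: "real v + real j - real k + 2 = real (Suc (v + 1 + j - k))" using assms True by simp
  have 3: "k - 2 * j + (j - 1) = k - j - 1" "v + 1 + j - k + (k - 2 * j) = v + 1 - j"
    using assms True by auto
  have b1: "real (k - j - 1 choose j) = fact (k - j - 1) / (fact j * fact (k - 2 * j - 1))"
    using assms by (subst binomial_fact) (auto simp: mult_2)
  have b2: "real (v + 1 - j choose (k - 2 * j)) =
      fact (v + 1 - j) / (fact (k - 2 * j) * fact (v + 1 + j - k))"
  proof -
    have "v + 1 - j - (k - 2 * j) = v + 1 + j - k" using assms True by simp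
    then show ?thesis using assms True by (subst binomial_fact) auto
  qed
  have "fence_ideal_bicount (2 * v + 1) (k - j) j =
      (k - j - 1 choose j) * (v + 1 - j choose (k - 2 * j))"
    using fence_ideal_bicount_eq[of "v + 1" "k - j" j] True by (simp add: mult_2)
  then show ?thesis
    unfolding 1 2 pochhammer_Suc_of_nat 3 by (simp only: of_nat_mult b1 b2) simp
next
  case False
  \<comment> \<open>The bounds on \<open>k\<close> give \<open>j \<le> v\<close>, hence
    \<open>k - j - v - 2 < k - 2 * j\<close>: the rising factorial starts at a nonpositive integer
    and runs through 0.\<close>
  have eq: "real v + real j - real k + 2 = - real (k - j - v - 2)" using assms False by simp
  have "pochhammer (real v + real j - real k + 2) (k - 2 * j) = 0"
    unfolding eq using assms False by (intro pochhammer_of_nat_eq_0_lemma) auto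
  moreover have "fence_ideal_bicount (2 * v + 1) (k - j) j = 0"
    using fence_ideal_bicount_eq[of "v + 1" "k - j" j] False by simp
  ultimately show ?thesis by simp
qed

theorem theorem2p2:
  fixes k v :: nat
  assumes "k \<le> 2 * v + 1"
  shows "real (fence_ideal_count (2 * v + 1) k) =
           real ((v + 1) choose k) +
           (\<Sum>j | 1 \<le> j \<and> 2 * j + 1 \<le> k.
              pochhammer (real k - 2 * real j + 1) (j - 1) *
              pochhammer (real v + real j - real k + 2) (k - 2 * j) /
              (fact j * fact (k - 2 * j - 1)))"
proof -
  let ?N = "\<lambda>j. fence_ideal_bicount (2 * v + 1) (k - j) j"
  let ?J = "{j. 1 \<le> j \<and> 2 * j + 1 \<le> k}"
  have N: "?N j = (if k - j \<le> v + 1 then (k - j - 1 choose j) * (v + 1 - j choose (k - j - j)) else 0)"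
    for j using fence_ideal_bicount_eq[of "v + 1" "k - j" j] by simp
  have N0: "?N j = 0" if "j \<le> k" "j \<notin> insert 0 ?J" for j
  proof -
    \<comment> \<open>Here \<open>1 \<le> j\<close> and \<open>k \<le> 2 * j\<close>; the inequality
      also holds for \<open>j = k\<close>, where the subtraction truncates to 0.\<close>
    from that have "k - j - 1 < j" by auto
    then show ?thesis unfolding N by (simp add: binomial_eq_0)
  qed
  have sub: "insert 0 ?J \<subseteq> {..k}" by auto
  have "fence_ideal_count (2 * v + 1) k = (\<Sum>j\<in>insert 0 ?J. ?N j)"
    unfolding fence_ideal_count_eq_sum_bicount 
    by (intro sum.mono_neutral_right sub ballI N0) auto
  also have "\<dots> = ?N 0 + (\<Sum>j\<in>?J. ?N j)"
    using finite_subset[OF sub] by (subst sum.insert) auto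
  \<comment> \<open>If \<open>k > v + 1\<close>, the guard gives 0, and so does the
    binomial.\<close>
  also have "?N 0 = (v + 1) choose k"
    using N[of 0] by simp
  finally have "real (fence_ideal_count (2 * v + 1) k) =
      real (v + 1 choose k) + (\<Sum>j\<in>?J. real (?N j))"
    by simp
  also have "(\<Sum>j\<in>?J. real (?N j)) = (\<Sum>j\<in>?J.
      pochhammer (real k - 2 * real j + 1) (j - 1) *
      pochhammer (real v + real j - real k + 2) (k - 2 * j) /
      (fact j * fact (k - 2 * j - 1)))"
    using assms by (intro sum.cong refl summand_eq_fence_ideal_bicount[symmetric]) auto
  finally show ?thesis .
qed

end
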